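(* Let $r\ge 2$ and let $K_1, K_2, \dots, K_r$ be closed convex subsets of a real Hilbert space $\mathcal{H}$ with $\bigcap_{j=1}^r K_j\neq\varnothing$. Let $V, W\subseteq \mathcal{H}^{r-1}$ and the operators $Q_V$, $P_W$ on $\mathcal{H}^{r-1}$ be as defined in the context, and let $S := P_WQ_V$ be the constraint-reduced MAP operator. Then the following statements hold. (a) $\operatorname{Fix} S = V\cap W = \{(x_1,x_2,\dots,x_{r-1}) : x_1 = x_2 = \dots = x_{r-1} \in \bigcap_{j=1}^r K_j\}$. (b) $S$ is $3/4$-averaged. If, in addition, $P_{K_{r-1}}(K_r) \subseteq K_r$ and $K_r$ is affine, then $S$ is $2/3$-averaged. (c) For any $\mathbf{x}_0\in \mathcal{H}^{r-1}$, the sequence $(\mathbf{x}_n)_{n\in \mathbb{N}}$ generated by $\mathbf{x}_{n+1} = S(\mathbf{x}_n)$ converges weakly to a point $\mathbf{x}^\ast = (x^\ast, x^\ast, \dots, x^\ast) \in V \cap W$ with $x^\ast \in \bigcap_{j=1}^r K_j$.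
   Context: $\mathcal{H}^{r-1}$ is the product Hilbert space with inner product $\langle\mathbf{x},\mathbf{y}\rangle=\sum_{j}\langle x_j,y_j\rangle$. $P_C$ denotes the (metric) projector onto a nonempty closed convex set $C$, and $P_C(K)=\{P_C(x):x\in K\}$. Define $$V := K_1\times \cdots \times K_{r-2} \times (K_{r-1}\cap K_r) \subseteq \mathcal{H}^{r-1},\qquad W := \{(x_1,\dots,x_{r-1})\in\mathcal{H}^{r-1} : x_1=\cdots=x_{r-1}\},$$ $$Q_V(\mathbf{x}) := \big(P_{K_1}(x_1),\dots,P_{K_{r-2}}(x_{r-2}),\,P_{K_{r-1}}P_{K_r}(x_{r-1})\big),\qquad P_W(\mathbf{x}) := \Big(\tfrac{1}{r-1}\sum_{j=1}^{r-1}x_j,\dots,\tfrac{1}{r-1}\sum_{j=1}^{r-1}x_j\Big)$$ for $\mathbf{x}=(x_1,\dots,x_{r-1})$ (for $r=2$, $V=K_1\cap K_2$ and $Q_V=P_{K_1}P_{K_2}$). $\operatorname{Fix}S$ is the set of fixed points of $S$. An operator $T$ defined on a subset $C$ of a Hilbert space is $\alpha$-averaged if $\alpha\in(0,1)$ and $T=(1-\alpha)\operatorname{I}+\alpha R$ for some nonexpansive (i.e. $1$-Lipschitz) operator $R$ on $C$; equivalently, $\|T(x)-T(y)\|^2+\frac{1-\alpha}{\alpha}\|(\operatorname{I}-T)(x)-(\operatorname{I}-T)(y)\|^2\le\|x-y\|^2$ for all $x,y\in C$. *)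

theory Defs
  imports "HOL-Analysis.Analysis"
begin

text \<open>
  A real Hilbert space is a type of sort \<open>{real_inner, complete_space}\<close>. The product
  space of \<open>r - 1\<close> copies of it is \<open>'a ^ 'n\<close>, whose library inner product is the sum of the
  inner products of the components. The argument \<open>e\<close> below is an enumeration of the index
  type, a bijection from \<open>{1..r - 1}\<close> onto \<open>UNIV :: 'n set\<close>; the component written
  \<open>x\<^sub>j\<close> on paper is \<open>x $ e j\<close>.
\<close>

text \<open>
  The library's \<open>closest_point\<close> is restricted to Heine-Borel (finite-dimensional) spaces.
\<close>

definition proj :: "'a::{real_inner,complete_space} set \<Rightarrow> 'a \<Rightarrow> 'a" where
  "proj C x = (THE p. p \<in> C \<and> (\<forall>y\<in>C. dist x p \<le> dist x y))"

definition Fix :: "('a \<Rightarrow> 'a) \<Rightarrow> 'a set" where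
  "Fix T = {x. T x = x}"

definition averaged_on :: "real \<Rightarrow> 'a::{real_inner,complete_space} set \<Rightarrow> ('a \<Rightarrow> 'a) \<Rightarrow> bool" where
  "averaged_on \<alpha> C T \<longleftrightarrow> 0 < \<alpha> \<and> \<alpha> < 1 \<and>
     (\<exists>R. 1-lipschitz_on C R \<and> (\<forall>x\<in>C. T x = (1 - \<alpha>) *\<^sub>R x + \<alpha> *\<^sub>R R x))"

definition weakly_converges :: "(nat \<Rightarrow> 'a::{real_inner,complete_space}) \<Rightarrow> 'a \<Rightarrow> bool" where
  "weakly_converges X l \<longleftrightarrow> (\<forall>u. (\<lambda>n. X n \<bullet> u) \<longlonglongrightarrow> l \<bullet> u)"

definition V_set ::
  "nat \<Rightarrow> (nat \<Rightarrow> 'n) \<Rightarrow> (nat \<Rightarrow> 'a::{real_inner,complete_space} set) \<Rightarrow> ('a ^ 'n::finite) set" where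
  "V_set r e K = {x. (\<forall>j\<in>{1..r - 2}. x $ e j \<in> K j) \<and> x $ e (r - 1) \<in> K (r - 1) \<inter> K r}"

definition W_set :: "('a::{real_inner,complete_space} ^ 'n::finite) set" where
  "W_set = {x. \<forall>i j. x $ i = x $ j}"

definition Q_V ::
  "nat \<Rightarrow> (nat \<Rightarrow> 'n) \<Rightarrow> (nat \<Rightarrow> 'a::{real_inner,complete_space} set) \<Rightarrow> 'a ^ 'n \<Rightarrow> 'a ^ 'n::finite" where
  "Q_V r e K x = (\<chi> i. let j = the_inv_into {1..r - 1} e i in
     if j = r - 1 then proj (K (r - 1)) (proj (K r) (x $ i)) else proj (K j) (x $ i))"

definition P_W ::
  "nat \<Rightarrow> (nat \<Rightarrow> 'n) \<Rightarrow> 'a::{real_inner,complete_space} ^ 'n \<Rightarrow> 'a ^ 'n::finite" where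
  "P_W r e x = (\<chi> i. (1 / real (r - 1)) *\<^sub>R (\<Sum>j=1..r - 1. x $ e j))"

definition reduced_MAP ::
  "nat \<Rightarrow> (nat \<Rightarrow> 'n) \<Rightarrow> (nat \<Rightarrow> 'a::{real_inner,complete_space} set) \<Rightarrow> 'a ^ 'n \<Rightarrow> 'a ^ 'n::finite" where
  "reduced_MAP r e K = P_W r e \<circ> Q_V r e K"

end

theory Submission
  imports Defs
begin

text \<open>
  Averagedness is measured here by the displacement \<open>x - T x\<close>: with
  \<open>\<tau> = \<alpha> / (1 - \<alpha>)\<close>, an operator is \<open>\<alpha>\<close>-averaged when the squared distance between two
  displacements is at most \<open>\<tau>\<close> times the amount by which the operator shrinks the squared
  distance of the points (\<open>displacement_bound\<close>). The displacement of a composition is the sum of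
  the displacements of its factors and the shrinkages also add up, so by a weighted
  Cauchy--Schwarz inequality the parameters \<open>\<tau>\<close> simply add (\<open>displacement_bound_comp\<close>).
  A projector has \<open>\<tau> = 1\<close>, and so does the mean operator \<open>P_W\<close>. Since norms in the product
  space are summed over coordinates, \<open>Q_V\<close> inherits the largest parameter of its coordinates:
  \<open>2\<close> because of the composed projectors, giving \<open>\<tau> = 1 + 2 = 3\<close> and \<open>\<alpha> = 3/4\<close> for
  \<open>P_W \<circ> Q_V\<close>. If \<open>K r\<close> is affine and invariant under the projector onto \<open>K (r - 1)\<close>, the
  composed projectors are the projector onto the intersection (\<open>proj_comp_eq_proj_Int\<close>), so
  \<open>\<tau> = 1 + 1 = 2\<close> and \<open>\<alpha> = 2/3\<close>.

  The same inequality identifies the fixed points: a point fixed by \<open>T \<circ> U\<close> keeps its distance to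
  any common fixed point of \<open>T\<close> and \<open>U\<close>, so \<open>U\<close> shrinks nothing and cannot displace it
  (\<open>Fix_comp\<close>). Applied in the last coordinate and then to \<open>P_W\<close> and \<open>Q_V\<close>, this gives
  \<open>V \<inter> W\<close>.

  For weak convergence, an asymptotic center replaces weak sequential compactness. The function
  \<open>y \<mapsto> limsup (norm (x n - y))\<^sup>2\<close> is strongly convex, so it has a unique minimizer. Displacements
  along the iterates tend to zero, which forces this minimizer to be a fixed point; the distances to
  a fixed point converge, which forces every subsequence to have the same minimizer \<open>c\<close>. If
  \<open>(x n - c) \<bullet> u\<close> stayed above some \<open>d > 0\<close> along a subsequence, moving \<open>c\<close> in the direction \<open>u\<close>
  would contradict minimality there. Projections are the special case of a constant sequence, which
  also provides their existence in an infinite-dimensional Hilbert space.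
\<close>

section \<open>Asymptotic centers\<close>

text \<open>
  The limit superior of \<open>(norm (X n - y))\<^sup>2\<close> along \<open>G\<close>, for bounded \<open>X\<close>
  and a proper filter. Filters play the role of subsequences:
  a subsequence picked by a recurring property is \<open>sequentially\<close> restricted to that property.
  The squared distance is used because its strong convexity inequality is linear in the values.
\<close>

definition sq_radius :: "'b filter \<Rightarrow> ('b \<Rightarrow> 'a::real_inner) \<Rightarrow> 'a \<Rightarrow> real" where
  "sq_radius G X y = Inf {b. \<forall>\<^sub>F n in G. (norm (X n - y))\<^sup>2 \<le> b}"

lemma sq_radius_le:
  assumes "G \<noteq> bot" and "\<forall>\<^sub>F n in G. (norm (X n - y))\<^sup>2 \<le> b"
  shows "sq_radius G X y \<le> b"
  unfolding sq_radius_def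
proof (rule cInf_lower)
  have "0 \<le> b'" if "\<forall>\<^sub>F n in G. (norm (X n - y))\<^sup>2 \<le> b'" for b'
    using eventually_happens'[OF assms(1) that] by (meson order_trans zero_le_power2)
  then show "bdd_below {b. \<forall>\<^sub>F n in G. (norm (X n - y))\<^sup>2 \<le> b}"
    by (intro bdd_belowI[of _ 0]) simp
qed (use assms in simp)

lemma eventually_le_of_sq_radius_less:
  assumes "Bfun X G" and "sq_radius G X y < b"
  shows "\<forall>\<^sub>F n in G. (norm (X n - y))\<^sup>2 \<le> b"
proof -
  obtain B where B: "\<forall>\<^sub>F n in G. norm (X n) \<le> B" using assms(1) by (auto simp: Bfun_def)
  have "\<forall>\<^sub>F n in G. (norm (X n - y))\<^sup>2 \<le> (B + norm y)\<^sup>2"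
    using B by eventually_elim (smt (verit) norm_ge_zero norm_triangle_ineq4 power_mono)
  then have ne: "{b. \<forall>\<^sub>F n in G. (norm (X n - y))\<^sup>2 \<le> b} \<noteq> {}" by blast
  obtain b' where "\<forall>\<^sub>F n in G. (norm (X n - y))\<^sup>2 \<le> b'" "b' < b"
    using cInf_lessD[OF ne assms(2)[unfolded sq_radius_def]] by blast
  then show ?thesis by (auto elim: eventually_mono)
qed

lemma sq_radius_nonneg:
  assumes "G \<noteq> bot" "Bfun X G" shows "0 \<le> sq_radius G X y"
proof (rule ccontr)
  assume neg: "\<not> 0 \<le> sq_radius G X y"
  then have "\<forall>\<^sub>F n in G. (norm (X n - y))\<^sup>2 \<le> sq_radius G X y / 2"
    by (intro eventually_le_of_sq_radius_less assms) simp
  from eventually_happens'[OF assms(1) this] neg show False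
    by (smt (verit) field_sum_of_halves zero_le_power2)
qed

text \<open>
  This identity, a weighted parallelogram law, is the source of all strong convexity below.
\<close>

lemma norm_sq_affine_combination:
  fixes a b :: "'a::real_inner"
  shows "(norm (v - ((1 - t) *\<^sub>R a + t *\<^sub>R b)))\<^sup>2 =
    (1 - t) * (norm (v - a))\<^sup>2 + t * (norm (v - b))\<^sup>2 - t * (1 - t) * (norm (a - b))\<^sup>2"
proof -
  define p q where "p = v - a" and "q = v - b"
  have "v - ((1 - t) *\<^sub>R a + t *\<^sub>R b) = (1 - t) *\<^sub>R p + t *\<^sub>R q" and "a - b = q - p"
    by (simp_all add: p_def q_def algebra_simps)
  moreover have "(norm ((1 - t) *\<^sub>R p + t *\<^sub>R q))\<^sup>2 =
      (1 - t)\<^sup>2 * (p \<bullet> p) + 2 * t * (1 - t) * (p \<bullet> q) + t\<^sup>2 * (q \<bullet> q)"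
    unfolding power2_norm_eq_inner inner_add_left inner_add_right inner_scaleR_left inner_scaleR_right
      inner_commute[of q p] by (simp add: power2_eq_square) algebra
  moreover have "(norm (q - p))\<^sup>2 = q \<bullet> q - 2 * (p \<bullet> q) + p \<bullet> p"
    by (simp add: power2_norm_eq_inner inner_diff_left inner_diff_right inner_commute)
  ultimately show ?thesis
    unfolding p_def[symmetric] q_def[symmetric] power2_norm_eq_inner[of p] power2_norm_eq_inner[of q]
    by (simp add: power2_eq_square) (simp add: algebra_simps)
qed

lemma sq_radius_strongly_convex:
  assumes G: "G \<noteq> bot" and X: "Bfun X G" and t: "0 \<le> t" "t \<le> 1"
  shows "sq_radius G X ((1 - t) *\<^sub>R a + t *\<^sub>R b) \<le>
    (1 - t) * sq_radius G X a + t * sq_radius G X b - t * (1 - t) * (norm (a - b))\<^sup>2"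
proof (rule field_le_epsilon)
  fix d :: real assume "0 < d"
  then have "\<forall>\<^sub>F n in G. (norm (X n - a))\<^sup>2 \<le> sq_radius G X a + d"
    and "\<forall>\<^sub>F n in G. (norm (X n - b))\<^sup>2 \<le> sq_radius G X b + d"
    by (auto intro!: eventually_le_of_sq_radius_less[OF X])
  then have "\<forall>\<^sub>F n in G. (norm (X n - ((1 - t) *\<^sub>R a + t *\<^sub>R b)))\<^sup>2 \<le>
      (1 - t) * (sq_radius G X a + d) + t * (sq_radius G X b + d) - t * (1 - t) * (norm (a - b))\<^sup>2"
    unfolding norm_sq_affine_combination
    by eventually_elim (use t in \<open>intro diff_right_mono add_mono mult_left_mono\<close>, auto)
  from sq_radius_le[OF G this]
  show "sq_radius G X ((1 - t) *\<^sub>R a + t *\<^sub>R b) \<le>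
      (1 - t) * sq_radius G X a + t * sq_radius G X b - t * (1 - t) * (norm (a - b))\<^sup>2 + d"
    by (simp add: algebra_simps)
qed

text \<open>
  A semicontinuity estimate: it bounds the value at a limit point \<open>c\<close> by the values along a
  sequence tending to \<open>c\<close>. The constant depends on \<open>c\<close> because the distance is squared.
\<close>

lemma sq_radius_le_nearby:
  assumes G: "G \<noteq> bot" and X: "Bfun X G"
  obtains B where "\<And>y. sq_radius G X c \<le> sq_radius G X y + B * norm (c - y)"
proof -
  obtain B where "\<forall>\<^sub>F n in G. norm (X n) \<le> B" using X by (auto simp: Bfun_def)
  then have B: "\<forall>\<^sub>F n in G. norm (X n - c) \<le> B + norm c"
    by eventually_elim (smt (verit) norm_triangle_ineq4)
  have "sq_radius G X c \<le> sq_radius G X y + 2 * (B + norm c) * norm (c - y)" for y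
  proof (rule field_le_epsilon)
    fix d :: real assume "0 < d"
    then have "\<forall>\<^sub>F n in G. (norm (X n - y))\<^sup>2 \<le> sq_radius G X y + d"
      by (auto intro!: eventually_le_of_sq_radius_less[OF X])
    with B have "\<forall>\<^sub>F n in G. (norm (X n - c))\<^sup>2 \<le> sq_radius G X y + d + 2 * (B + norm c) * norm (c - y)"
    proof eventually_elim
      case (elim n)
      have "(norm (X n - y))\<^sup>2 = (norm (X n - c))\<^sup>2 + 2 * ((X n - c) \<bullet> (c - y)) + (norm (c - y))\<^sup>2"
        by (simp add: power2_norm_eq_inner inner_diff_left inner_diff_right inner_commute)
      moreover have "- ((X n - c) \<bullet> (c - y)) \<le> norm (X n - c) * norm (c - y)"
        using Cauchy_Schwarz_ineq2[of "X n - c" "c - y"] by linarith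
      moreover have "norm (X n - c) * norm (c - y) \<le> (B + norm c) * norm (c - y)"
        using elim by (intro mult_right_mono) auto
      ultimately show ?case using elim zero_le_power2[of "norm (c - y)"] by linarith
    qed
    from sq_radius_le[OF G this]
    show "sq_radius G X c \<le> sq_radius G X y + 2 * (B + norm c) * norm (c - y) + d" by simp
  qed
  then show thesis by (rule that)
qed

text \<open>
  A minimizing sequence is Cauchy by strong convexity at midpoints, so completeness yields a
  minimizer. The excess term \<open>(norm (y - c))\<^sup>2\<close> carries both uniqueness of the center and, for a
  constant family, the variational inequality of the projection.
\<close>

lemma asymptotic_center_exists:
  fixes X :: "'b \<Rightarrow> 'a::{real_inner,complete_space}"
  assumes G: "G \<noteq> bot" and X: "Bfun X G" and C: "closed C" "convex C" "C \<noteq> {}"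
  obtains c where "c \<in> C" and "\<And>y. y \<in> C \<Longrightarrow> sq_radius G X c + (norm (y - c))\<^sup>2 \<le> sq_radius G X y"
proof -
  let ?f = "sq_radius G X"
  define m where "m = Inf (?f ` C)"
  have bdd: "bdd_below (?f ` C)"
    by (intro bdd_belowI[of _ 0]) (auto intro: sq_radius_nonneg[OF G X])
  have m: "m \<le> ?f y" if "y \<in> C" for y
    unfolding m_def using that by (intro cInf_lower bdd) auto
  have "\<exists>y\<in>C. ?f y < m + inverse (real (Suc n))" for n
  proof -
    have "Inf (?f ` C) < m + inverse (real (Suc n))" unfolding m_def by simp
    from cInf_lessD[OF _ this] C show ?thesis by auto
  qed
  then obtain y where yC: "\<And>n. y n \<in> C" and y: "\<And>n. ?f (y n) < m + inverse (real (Suc n))"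
    by metis
  have gap: "(norm (y n - y k))\<^sup>2 \<le> 2 * (inverse (real (Suc n)) + inverse (real (Suc k)))" for n k
  proof -
    \<comment> \<open>The midpoint has value at least \<open>m\<close>, while both endpoints have values close to \<open>m\<close>.\<close>
    have "(1 - 1/2) *\<^sub>R y n + (1/2) *\<^sub>R y k \<in> C"
      by (rule convexD[OF C(2)]) (use yC in auto)
    from order_trans[OF m[OF this] sq_radius_strongly_convex[OF G X]] y[of n] y[of k]
    show ?thesis by simp
  qed
  have "Cauchy y"
  proof (rule metric_CauchyI)
    fix d :: real assume "0 < d"
    then obtain N where N: "inverse (real (Suc N)) < d\<^sup>2 / 4"
      using reals_Archimedean[of "d\<^sup>2 / 4"] by auto
    have "dist (y n) (y k) < d" if "n \<ge> N" "k \<ge> N" for n k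
    proof -
      have "inverse (real (Suc n)) \<le> inverse (real (Suc N))" "inverse (real (Suc k)) \<le> inverse (real (Suc N))"
        using that by (auto intro!: le_imp_inverse_le)
      with gap[of n k] N have "(norm (y n - y k))\<^sup>2 < d\<^sup>2" by argo
      then show ?thesis using \<open>0 < d\<close> by (simp add: dist_norm power2_less_imp_less)
    qed
    then show "\<exists>N. \<forall>n\<ge>N. \<forall>k\<ge>N. dist (y n) (y k) < d" by blast
  qed
  then obtain c where lim: "y \<longlonglongrightarrow> c" using Cauchy_convergent convergent_def by blast
  have cC: "c \<in> C" using closed_sequentially[OF C(1)] yC lim by blast
  obtain B where B: "\<And>y. ?f c \<le> ?f y + B * norm (c - y)"
    using sq_radius_le_nearby[OF G X, where c = c] by blast
  have "(\<lambda>n. (m + inverse (real (Suc n))) + B * norm (c - y n)) \<longlonglongrightarrow> (m + 0) + B * norm (c - c)"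
    by (intro tendsto_intros lim LIMSEQ_inverse_real_of_nat)
  moreover have "?f c \<le> (m + inverse (real (Suc n))) + B * norm (c - y n)" for n
    using B[of "y n"] y[of n] by linarith
  ultimately have "?f c \<le> (m + 0) + B * norm (c - c)"
    by (intro LIMSEQ_le_const) auto
  then have fc: "?f c \<le> m" by simp
  have "?f c + (norm (z - c))\<^sup>2 \<le> ?f z" if z: "z \<in> C" for z
  proof -
    \<comment> \<open>Strong convexity on the segment from \<open>c\<close> to \<open>z\<close>, divided by \<open>t\<close>; then \<open>t\<close> tends to 0.\<close>
    have ineq: "(1 - t) * (norm (z - c))\<^sup>2 \<le> ?f z - ?f c" if t: "0 < t" "t \<le> 1" for t
    proof -
      have "(1 - t) *\<^sub>R c + t *\<^sub>R z \<in> C" by (rule convexD[OF C(2)]) (use t cC z in auto)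
      then have "?f c \<le> ?f ((1 - t) *\<^sub>R c + t *\<^sub>R z)" using fc m by fastforce
      also have "\<dots> \<le> (1 - t) * ?f c + t * ?f z - t * (1 - t) * (norm (c - z))\<^sup>2"
        using sq_radius_strongly_convex[OF G X] t by simp
      finally have "t * ((1 - t) * (norm (z - c))\<^sup>2) \<le> t * (?f z - ?f c)"
        by (simp add: norm_minus_commute algebra_simps)
      then show ?thesis using t by simp
    qed
    have "((\<lambda>t. (1 - t) * (norm (z - c))\<^sup>2) \<longlongrightarrow> (1 - 0) * (norm (z - c))\<^sup>2) (at_right 0)"
      by (intro tendsto_intros)
    then have "(1 - 0) * (norm (z - c))\<^sup>2 \<le> ?f z - ?f c"
    proof (rule tendsto_upperbound)
      show "\<forall>\<^sub>F t in at_right 0. (1 - t) * (norm (z - c))\<^sup>2 \<le> ?f z - ?f c"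
        unfolding eventually_at_right_field using ineq by (intro exI[of _ 1]) auto
    qed simp
    then show ?thesis by simp
  qed
  with cC show thesis by (rule that)
qed

section \<open>Metric projections\<close>

lemma sq_radius_const: "G \<noteq> bot \<Longrightarrow> sq_radius G (\<lambda>_. x) y = (norm (x - y))\<^sup>2"
  by (simp add: sq_radius_def eventually_const_iff atLeast_def[symmetric])

lemma proj_unique:
  fixes C :: "'a::{real_inner,complete_space} set"
  assumes "p \<in> C" and var: "\<And>y. y \<in> C \<Longrightarrow> (x - p) \<bullet> (y - p) \<le> 0"
  shows "proj C x = p"
  unfolding proj_def
proof (rule the_equality)
  have *: "(dist x p)\<^sup>2 + (dist y p)\<^sup>2 \<le> (dist x y)\<^sup>2" if "y \<in> C" for y
    using var[OF that]
    by (simp add: dist_norm power2_norm_eq_inner inner_diff_left inner_diff_right inner_commute)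
  have "dist x p \<le> dist x y" if "y \<in> C" for y
    using *[OF that] by (smt (verit) zero_le_dist power2_le_imp_le zero_le_power2)
  then show "p \<in> C \<and> (\<forall>y\<in>C. dist x p \<le> dist x y)" using assms(1) by blast
  fix q assume q: "q \<in> C \<and> (\<forall>y\<in>C. dist x q \<le> dist x y)"
  then have "(dist x q)\<^sup>2 \<le> (dist x p)\<^sup>2" using assms(1) by (intro power_mono) auto
  with *[of q] q have "(dist q p)\<^sup>2 \<le> 0" by linarith
  then show "q = p" by simp
qed

lemma
  fixes C :: "'a::{real_inner,complete_space} set"
  assumes "closed C" "convex C" "C \<noteq> {}"
  shows proj_in: "proj C x \<in> C"
    and proj_variational: "y \<in> C \<Longrightarrow> (x - proj C x) \<bullet> (y - proj C x) \<le> 0"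
proof -
  obtain p where p: "p \<in> C" and
    le: "\<And>y. y \<in> C \<Longrightarrow> sq_radius sequentially (\<lambda>_. x) p + (norm (y - p))\<^sup>2 \<le> sq_radius sequentially (\<lambda>_. x) y"
    using asymptotic_center_exists[of sequentially "\<lambda>_. x", OF _ _ assms] by (auto simp: Bfun_const)
  have var: "(x - p) \<bullet> (y - p) \<le> 0" if "y \<in> C" for y
    using le[OF that]
    by (simp add: sq_radius_const power2_norm_eq_inner inner_diff_left inner_diff_right inner_commute)
  from proj_unique[OF p var] p var
  show "proj C x \<in> C" and "y \<in> C \<Longrightarrow> (x - proj C x) \<bullet> (y - proj C x) \<le> 0" by auto
qed

lemma Fix_proj:
  fixes C :: "'a::{real_inner,complete_space} set"
  assumes "closed C" "convex C" "C \<noteq> {}"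
  shows "Fix (proj C) = C"
proof -
  have "proj C x = x" if "x \<in> C" for x by (rule proj_unique) (use that in auto)
  moreover have "x \<in> C" if "proj C x = x" for x using proj_in[OF assms, of x] that by simp
  ultimately show ?thesis unfolding Fix_def by blast
qed

text \<open>
  By \<open>proj_unique\<close> it suffices to check the variational inequality at \<open>proj A (proj B x)\<close>.
  The residual \<open>x - proj B x\<close> is harmless because directions between points of the affine set \<open>B\<close>
  can be translated to start at \<open>proj B x\<close>; the residual of the second projection is controlled by
  the variational inequality for \<open>A\<close>.
\<close>

lemma proj_comp_eq_proj_Int:
  fixes A B :: "'a::{real_inner,complete_space} set"
  assumes A: "closed A" "convex A" and B: "closed B" "affine B"
    and ne: "A \<inter> B \<noteq> {}" and inv: "proj A ` B \<subseteq> B"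
  shows "proj A (proj B x) = proj (A \<inter> B) x"
proof -
  have ne': "A \<noteq> {}" "B \<noteq> {}" using ne by auto
  have cB: "convex B" using B(2) by (rule affine_imp_convex)
  let ?q = "proj B x" and ?p = "proj A (proj B x)"
  have q: "?q \<in> B" by (rule proj_in[OF B(1) cB ne'(2)])
  have p: "?p \<in> A \<inter> B" using proj_in[OF A ne'(1)] q inv by blast
  have "proj (A \<inter> B) x = ?p"
  proof (rule proj_unique[OF p])
    fix y assume y: "y \<in> A \<inter> B"
    \<comment> \<open>The segment from \<open>?p\<close> to \<open>y\<close>, translated to start at \<open>?q\<close>, ends in \<open>B\<close>.\<close>
    have shift: "?q + (y - ?p) \<in> B"
      using mem_affine_3_minus[OF B(2) q, of y ?p 1] y p by simp
    have "(x - ?q) \<bullet> (y - ?p) \<le> 0"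
      using proj_variational[OF B(1) cB ne'(2) shift, of x] by simp
    moreover have "(?q - ?p) \<bullet> (y - ?p) \<le> 0"
      using proj_variational[OF A ne'(1)] y by blast
    ultimately show "(x - ?p) \<bullet> (y - ?p) \<le> 0"
      by (simp add: inner_diff_left)
  qed
  then show ?thesis by simp
qed

section \<open>Averaged operators\<close>

text \<open>
  For \<open>\<tau> > 0\<close> this is the inequality characterizing \<open>\<alpha>\<close>-averaged operators, where
  \<open>\<tau> = \<alpha> / (1 - \<alpha>)\<close>. The parameter \<open>\<tau>\<close> makes the composition rule additive, and \<open>\<tau> = 1\<close> is
  firm nonexpansiveness.
\<close>

definition displacement_bound :: "real \<Rightarrow> ('a::real_inner \<Rightarrow> 'a) \<Rightarrow> bool" where
  "displacement_bound \<tau> T \<longleftrightarrow>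
    (\<forall>x y. (norm ((x - T x) - (y - T y)))\<^sup>2 \<le> \<tau> * ((norm (x - y))\<^sup>2 - (norm (T x - T y))\<^sup>2))"

lemma displacement_boundD:
  "displacement_bound \<tau> T \<Longrightarrow>
    (norm ((x - T x) - (y - T y)))\<^sup>2 \<le> \<tau> * ((norm (x - y))\<^sup>2 - (norm (T x - T y))\<^sup>2)"
  by (simp add: displacement_bound_def)

lemma displacement_bound_nonexpansive:
  assumes "displacement_bound \<tau> T" "0 < \<tau>"
  shows "norm (T x - T y) \<le> norm (x - y)"
proof -
  have "0 \<le> \<tau> * ((norm (x - y))\<^sup>2 - (norm (T x - T y))\<^sup>2)"
    using displacement_boundD[OF assms(1)] by (rule order_trans[OF zero_le_power2])
  then have "(norm (T x - T y))\<^sup>2 \<le> (norm (x - y))\<^sup>2" using assms(2) by (simp add: zero_le_mult_iff)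
  then show ?thesis by (rule power2_le_imp_le) simp
qed

lemma displacement_bound_mono:
  assumes T: "displacement_bound \<sigma> T" and "0 < \<sigma>" "\<sigma> \<le> \<tau>"
  shows "displacement_bound \<tau> T"
  unfolding displacement_bound_def
proof (intro allI)
  fix x y
  have "0 \<le> (norm (x - y))\<^sup>2 - (norm (T x - T y))\<^sup>2"
    using displacement_bound_nonexpansive[OF T assms(2)] by (simp add: power_mono)
  from mult_right_mono[OF assms(3) this] displacement_boundD[OF T, of x y]
  show "(norm ((x - T x) - (y - T y)))\<^sup>2 \<le> \<tau> * ((norm (x - y))\<^sup>2 - (norm (T x - T y))\<^sup>2)"
    by linarith
qed

lemma displacement_bound_averaged:
  fixes T :: "'a::{real_inner,complete_space} \<Rightarrow> 'a"
  assumes T: "displacement_bound \<tau> T" and "0 < \<tau>"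
  shows "averaged_on (\<tau> / (1 + \<tau>)) UNIV T"
proof -
  \<comment> \<open>The only candidate for \<open>R\<close>: solve \<open>T x = (1 - \<alpha>) *\<^sub>R x + \<alpha> *\<^sub>R R x\<close> with \<open>\<alpha> = \<tau> / (1 + \<tau>)\<close>.\<close>
  define R where "R x = (1 / \<tau>) *\<^sub>R ((1 + \<tau>) *\<^sub>R T x - x)" for x
  have R: "\<tau> *\<^sub>R R x = (1 + \<tau>) *\<^sub>R T x - x" for x
    using \<open>0 < \<tau>\<close> by (simp add: R_def)
  have "norm (R x - R y) \<le> norm (x - y)" for x y
  proof -
    define d where "d = x - y"
    define u where "u = T x - T y"
    have "(norm (d - u))\<^sup>2 \<le> \<tau> * ((norm d)\<^sup>2 - (norm u)\<^sup>2)"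
    proof -
      have "(x - T x) - (y - T y) = d - u" by (simp add: d_def u_def)
      then show ?thesis using displacement_boundD[OF T, of x y] by (simp only: d_def[symmetric] u_def[symmetric])
    qed
    moreover have "(norm (d - u))\<^sup>2 = (norm d)\<^sup>2 - 2 * (u \<bullet> d) + (norm u)\<^sup>2"
      unfolding power2_norm_eq_inner by (simp add: inner_diff_left inner_diff_right inner_commute)
    ultimately have "(1 + \<tau>) * (norm u)\<^sup>2 - 2 * (u \<bullet> d) \<le> (\<tau> - 1) * (norm d)\<^sup>2"
      unfolding distrib_right left_diff_distrib right_diff_distrib by linarith
    then have "(1 + \<tau>) * ((1 + \<tau>) * (norm u)\<^sup>2 - 2 * (u \<bullet> d)) \<le> (1 + \<tau>) * ((\<tau> - 1) * (norm d)\<^sup>2)"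
      using \<open>0 < \<tau>\<close> by (intro mult_left_mono) auto
    moreover have "(norm ((1 + \<tau>) *\<^sub>R u - d))\<^sup>2 =
        (1 + \<tau>) * ((1 + \<tau>) * (norm u)\<^sup>2 - 2 * (u \<bullet> d)) + (norm d)\<^sup>2"
      unfolding power2_norm_eq_inner inner_diff_left inner_diff_right inner_scaleR_left
        inner_scaleR_right inner_commute[of d u] by algebra
    moreover have "(1 + \<tau>) * ((\<tau> - 1) * (norm d)\<^sup>2) + (norm d)\<^sup>2 = (\<tau> * norm d)\<^sup>2"
      by algebra
    ultimately have "(norm ((1 + \<tau>) *\<^sub>R u - d))\<^sup>2 \<le> (\<tau> * norm d)\<^sup>2" by linarith
    then have "norm ((1 + \<tau>) *\<^sub>R u - d) \<le> \<tau> * norm d"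
      by (rule power2_le_imp_le) (use \<open>0 < \<tau>\<close> in simp)
    moreover have "\<tau> *\<^sub>R (R x - R y) = (1 + \<tau>) *\<^sub>R u - d"
      unfolding scaleR_diff_right R u_def d_def by simp
    then have "\<tau> * norm (R x - R y) = norm ((1 + \<tau>) *\<^sub>R u - d)"
      using \<open>0 < \<tau>\<close> by (metis abs_of_pos norm_scaleR)
    ultimately have "\<tau> * norm (R x - R y) \<le> \<tau> * norm d" by linarith
    then show ?thesis using \<open>0 < \<tau>\<close> by (simp add: d_def)
  qed
  then have "1-lipschitz_on UNIV R" by (intro lipschitz_onI) (auto simp: dist_norm)
  moreover have "T x = (1 - \<tau> / (1 + \<tau>)) *\<^sub>R x + (\<tau> / (1 + \<tau>)) *\<^sub>R R x" for x
  proof -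
    have "(\<tau> / (1 + \<tau>)) *\<^sub>R R x = (1 / (1 + \<tau>)) *\<^sub>R (\<tau> *\<^sub>R R x)" by simp
    also have "\<dots> = T x - (1 / (1 + \<tau>)) *\<^sub>R x"
      unfolding R scaleR_diff_right using \<open>0 < \<tau>\<close> by simp
    finally have "(\<tau> / (1 + \<tau>)) *\<^sub>R R x = T x - (1 / (1 + \<tau>)) *\<^sub>R x" .
    moreover have "1 - \<tau> / (1 + \<tau>) = 1 / (1 + \<tau>)" using \<open>0 < \<tau>\<close> by (simp add: field_simps)
    ultimately show ?thesis by simp
  qed
  moreover have "0 < \<tau> / (1 + \<tau>)" "\<tau> / (1 + \<tau>) < 1" using \<open>0 < \<tau>\<close> by simp_all
  ultimately show ?thesis unfolding averaged_on_def by blast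
qed

text \<open>
  A consequence of the nonnegativity of \<open>(norm (t *\<^sub>R a - s *\<^sub>R b))\<^sup>2\<close>; with \<open>a\<close> and \<open>b\<close> the
  displacement differences of two operators and \<open>p\<close>, \<open>q\<close> their shrinkages, it is the
  composition rule.
\<close>

lemma norm_add_sq_le_weighted:
  fixes a b :: "'a::real_inner"
  assumes "0 < s" "0 < t" "(norm a)\<^sup>2 \<le> s * p" "(norm b)\<^sup>2 \<le> t * q"
  shows "(norm (a + b))\<^sup>2 \<le> (s + t) * (p + q)"
proof -
  have "(norm (t *\<^sub>R a - s *\<^sub>R b))\<^sup>2 =
      t\<^sup>2 * (norm a)\<^sup>2 - 2 * (a \<bullet> b) * (s * t) + s\<^sup>2 * (norm b)\<^sup>2"
    unfolding power2_norm_eq_inner inner_diff_left inner_diff_right inner_scaleR_left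
      inner_scaleR_right inner_commute[of b a] by algebra
  then have "2 * (a \<bullet> b) * (s * t) \<le> t\<^sup>2 * (norm a)\<^sup>2 + s\<^sup>2 * (norm b)\<^sup>2"
    using zero_le_power2[of "norm (t *\<^sub>R a - s *\<^sub>R b)"] by linarith
  also have "\<dots> \<le> t\<^sup>2 * (s * p) + s\<^sup>2 * (t * q)"
    using assms by (intro add_mono mult_left_mono) auto
  also have "\<dots> = (t * p + s * q) * (s * t)" by (simp add: power2_eq_square algebra_simps)
  finally have "2 * (a \<bullet> b) \<le> t * p + s * q" using assms by simp
  moreover have "(norm (a + b))\<^sup>2 = (norm a)\<^sup>2 + 2 * (a \<bullet> b) + (norm b)\<^sup>2"
    by (simp add: power2_norm_eq_inner inner_add_left inner_add_right inner_commute)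
  ultimately show ?thesis using assms by (simp add: algebra_simps)
qed

lemma displacement_bound_comp:
  assumes T: "displacement_bound \<tau> T" "0 < \<tau>" and U: "displacement_bound \<sigma> U" "0 < \<sigma>"
  shows "displacement_bound (\<tau> + \<sigma>) (T \<circ> U)"
  unfolding displacement_bound_def
proof (intro allI)
  fix x y
  from norm_add_sq_le_weighted[OF T(2) U(2) displacement_boundD[OF T(1), of "U x" "U y"]
      displacement_boundD[OF U(1), of x y]]
  show "(norm ((x - (T \<circ> U) x) - (y - (T \<circ> U) y)))\<^sup>2 \<le>
      (\<tau> + \<sigma>) * ((norm (x - y))\<^sup>2 - (norm ((T \<circ> U) x - (T \<circ> U) y))\<^sup>2)"
    by (simp add: algebra_simps)
qed

text \<open>
  For \<open>x = T (U x)\<close> and a common fixed point \<open>p\<close>, the distances to \<open>p\<close> of \<open>x\<close>, \<open>U x\<close> and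
  \<open>T (U x) = x\<close> decrease weakly, hence agree; \<open>U\<close> then displaces \<open>x\<close> no more than \<open>p\<close>.
\<close>

lemma Fix_comp:
  assumes T: "displacement_bound \<tau> T" "0 < \<tau>" and U: "displacement_bound \<sigma> U" "0 < \<sigma>"
    and ne: "Fix T \<inter> Fix U \<noteq> {}"
  shows "Fix (T \<circ> U) = Fix T \<inter> Fix U"
proof
  obtain p where p: "T p = p" "U p = p" using ne by (auto simp: Fix_def)
  show "Fix (T \<circ> U) \<subseteq> Fix T \<inter> Fix U"
  proof
    fix x assume "x \<in> Fix (T \<circ> U)"
    then have x: "T (U x) = x" by (simp add: Fix_def)
    have "norm (x - p) \<le> norm (U x - p)"
      using displacement_bound_nonexpansive[OF T, of "U x" p] x p by simp
    then have "\<sigma> * ((norm (x - p))\<^sup>2 - (norm (U x - p))\<^sup>2) \<le> 0"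
      using U(2) by (simp add: mult_le_0_iff power_mono)
    with displacement_boundD[OF U(1), of x p] p
    have "(norm (x - U x))\<^sup>2 \<le> 0" by (metis diff_self diff_zero order_trans)
    then have "U x = x" by simp
    with x show "x \<in> Fix T \<inter> Fix U" by (simp add: Fix_def)
  qed
qed (auto simp: Fix_def)

text \<open>
  Firm nonexpansiveness: add the variational inequalities at \<open>proj C x\<close> and \<open>proj C y\<close>, each
  tested with the other point.
\<close>

lemma displacement_bound_proj:
  fixes C :: "'a::{real_inner,complete_space} set"
  assumes C: "closed C" "convex C" "C \<noteq> {}"
  shows "displacement_bound 1 (proj C)"
  unfolding displacement_bound_def
proof (intro allI)
  fix x y
  have "(x - proj C x) \<bullet> (proj C y - proj C x) \<le> 0" "(y - proj C y) \<bullet> (proj C x - proj C y) \<le> 0"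
    by (intro proj_variational[OF C] proj_in[OF C])+
  then show "(norm ((x - proj C x) - (y - proj C y)))\<^sup>2 \<le>
      1 * ((norm (x - y))\<^sup>2 - (norm (proj C x - proj C y))\<^sup>2)"
    by (simp add: power2_norm_eq_inner inner_diff_left inner_diff_right inner_commute)
qed

section \<open>Weak convergence of the iterates\<close>

text \<open>
  The Krasnoselskii--Mann theorem. Three facts about the iterates are combined: distances to fixed
  points are decreasing (\<open>fejer\<close>), displacements tend to zero (\<open>regular\<close>), and asymptotic centers
  along all subfilters are fixed points (\<open>center\<close>) and coincide. A center common to all
  subfilters is a weak limit.
\<close>

lemma averaged_iterates_weakly_converge:
  fixes T :: "'a::{real_inner,complete_space} \<Rightarrow> 'a"
  assumes T: "displacement_bound \<tau> T" "0 < \<tau>" and ne: "Fix T \<noteq> {}"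
    and x: "\<And>n. x (Suc n) = T (x n)"
  obtains c where "c \<in> Fix T" and "weakly_converges x c"
proof -
  have fejer: "\<exists>L. (\<lambda>n. (norm (x n - p))\<^sup>2) \<longlonglongrightarrow> L" if "p \<in> Fix T" for p
  proof -
    have "norm (x (Suc n) - p) \<le> norm (x n - p)" for n
      using displacement_bound_nonexpansive[OF T, of "x n" p] that x by (simp add: Fix_def)
    then have "decseq (\<lambda>n. (norm (x n - p))\<^sup>2)"
      by (intro decseq_SucI power_mono) auto
    then show ?thesis using decseq_convergent[of _ 0] by (metis zero_le_power2)
  qed
  obtain p where p: "p \<in> Fix T" using ne by blast
  \<comment> \<open>The shrinkage at step \<open>n\<close> is a difference of consecutive terms of a convergent sequence.\<close>
  have regular: "(\<lambda>n. (norm (x n - T (x n)))\<^sup>2) \<longlonglongrightarrow> 0"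
  proof -
    obtain L where L: "(\<lambda>n. (norm (x n - p))\<^sup>2) \<longlonglongrightarrow> L" using fejer[OF p] by blast
    have "(\<lambda>n. \<tau> * ((norm (x n - p))\<^sup>2 - (norm (x (Suc n) - p))\<^sup>2)) \<longlonglongrightarrow> \<tau> * (L - L)"
      by (intro tendsto_intros L LIMSEQ_Suc[OF L])
    then have "(\<lambda>n. \<tau> * ((norm (x n - p))\<^sup>2 - (norm (x (Suc n) - p))\<^sup>2)) \<longlonglongrightarrow> 0" by simp
    then show ?thesis
    proof (rule Lim_null_comparison[rotated])
      show "\<forall>\<^sub>F n in sequentially. norm ((norm (x n - T (x n)))\<^sup>2) \<le>
          \<tau> * ((norm (x n - p))\<^sup>2 - (norm (x (Suc n) - p))\<^sup>2)"
        using displacement_boundD[OF T(1), of _ p] p x by (simp add: Fix_def)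
    qed
  qed
  then have step: "(\<lambda>n. norm (x n - T (x n))) \<longlonglongrightarrow> 0"
    using tendsto_real_sqrt[OF regular] by simp
  have "Bseq (\<lambda>n. (norm (x n - p))\<^sup>2)"
    using fejer[OF p] convergent_imp_Bseq convergent_def by blast
  then obtain M where M: "\<And>n. (norm (x n - p))\<^sup>2 \<le> M" by (auto simp: Bseq_def)
  have "norm (x n) \<le> sqrt M + norm p" for n
    using real_le_rsqrt[OF M[of n]] by (smt (verit) norm_triangle_sub)
  then have bdd: "Bfun x sequentially" by (intro BfunI[where K = "sqrt M + norm p"]) simp
  have center: "\<exists>c\<in>Fix T. \<forall>y. sq_radius G x c + (norm (y - c))\<^sup>2 \<le> sq_radius G x y"
    if G: "G \<noteq> bot" "G \<le> sequentially" for G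
  proof -
    have X: "Bfun x G" using bdd G(2) unfolding Bfun_def by (meson filter_leD)
    obtain c where c: "\<And>y. sq_radius G x c + (norm (y - c))\<^sup>2 \<le> sq_radius G x y"
      using asymptotic_center_exists[OF G(1) X closed_UNIV convex_UNIV] by auto
    \<comment> \<open>\<open>T c\<close> is asymptotically as close to \<open>x n\<close> as \<open>c\<close> is, since \<open>T (x n)\<close> is close to \<open>x n\<close>; uniqueness of the center then gives \<open>T c = c\<close>.\<close>
    have "sq_radius G x (T c) \<le> sq_radius G x c"
    proof (rule field_le_epsilon)
      fix d :: real assume "0 < d"
      define b where "b = sq_radius G x c + d / 2"
      have "0 \<le> b" using sq_radius_nonneg[OF G(1) X, of c] \<open>0 < d\<close> by (simp add: b_def)
      have ev: "\<forall>\<^sub>F n in G. (norm (x n - c))\<^sup>2 \<le> b"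
        unfolding b_def using \<open>0 < d\<close> by (intro eventually_le_of_sq_radius_less[OF X]) simp
      have "(\<lambda>n. (norm (x n - T (x n)) + sqrt b)\<^sup>2) \<longlonglongrightarrow> (0 + sqrt b)\<^sup>2"
        by (intro tendsto_intros step)
      then have "\<forall>\<^sub>F n in sequentially. (norm (x n - T (x n)) + sqrt b)\<^sup>2 < b + d / 2"
        using \<open>0 < d\<close> \<open>0 \<le> b\<close> by (intro order_tendstoD(2)) auto
      then have "\<forall>\<^sub>F n in G. (norm (x n - T (x n)) + sqrt b)\<^sup>2 < b + d / 2"
        by (rule filter_leD[OF G(2)])
      with ev have "\<forall>\<^sub>F n in G. (norm (x n - T c))\<^sup>2 \<le> b + d / 2"
      proof eventually_elim
        case (elim n)
        have "norm (x n - T c) \<le> norm (x n - T (x n)) + norm (T (x n) - T c)"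
          using norm_triangle_ineq[of "x n - T (x n)" "T (x n) - T c"] by simp
        also have "norm (T (x n) - T c) \<le> norm (x n - c)"
          by (rule displacement_bound_nonexpansive[OF T])
        also have "norm (x n - c) \<le> sqrt b" using elim(1) by (rule real_le_rsqrt)
        finally have "(norm (x n - T c))\<^sup>2 \<le> (norm (x n - T (x n)) + sqrt b)\<^sup>2"
          by (intro power_mono) auto
        with elim(2) show ?case by simp
      qed
      from sq_radius_le[OF G(1) this] show "sq_radius G x (T c) \<le> sq_radius G x c + d"
        by (simp add: b_def)
    qed
    with c[of "T c"] have "(norm (T c - c))\<^sup>2 \<le> 0" by linarith
    then have "c \<in> Fix T" by (simp add: Fix_def)
    with c show ?thesis by blast
  qed
  \<comment> \<open>At a fixed point the limit superior is a limit, so it is the same along every subfilter.\<close>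
  have radius_Fix: "sq_radius G x q = sq_radius sequentially x q"
    if G: "G \<noteq> bot" "G \<le> sequentially" and q: "q \<in> Fix T" for G q
  proof -
    obtain L where L: "(\<lambda>n. (norm (x n - q))\<^sup>2) \<longlonglongrightarrow> L" using fejer[OF q] by blast
    have "sq_radius H x q = L" if H: "H \<noteq> bot" "H \<le> sequentially" for H
    proof (rule antisym)
      have X: "Bfun x H" using bdd H(2) unfolding Bfun_def by (meson filter_leD)
      have LH: "((\<lambda>n. (norm (x n - q))\<^sup>2) \<longlongrightarrow> L) H" using L H(2) by (rule tendsto_mono[rotated])
      show "sq_radius H x q \<le> L"
      proof (rule field_le_epsilon)
        fix d :: real assume "0 < d"
        then have "\<forall>\<^sub>F n in H. (norm (x n - q))\<^sup>2 < L + d" by (intro order_tendstoD(2)[OF LH]) simp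
        then show "sq_radius H x q \<le> L + d"
          by (intro sq_radius_le H(1)) (auto elim: eventually_mono)
      qed
      show "L \<le> sq_radius H x q"
      proof (rule field_le_epsilon)
        fix d :: real assume "0 < d"
        then have "\<forall>\<^sub>F n in H. (norm (x n - q))\<^sup>2 \<le> sq_radius H x q + d"
          by (intro eventually_le_of_sq_radius_less X) simp
        then show "L \<le> sq_radius H x q + d" using tendsto_upperbound[OF LH _ H(1)] by blast
      qed
    qed
    with G show ?thesis by simp
  qed
  obtain c where c: "c \<in> Fix T"
    and cmin: "\<And>y. sq_radius sequentially x c + (norm (y - c))\<^sup>2 \<le> sq_radius sequentially x y"
    using center[of sequentially] by auto
  have no_drift: "\<not> (\<exists>\<^sub>F n in sequentially. d \<le> (x n - c) \<bullet> u)" if "0 < d" for d u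
  proof
    assume freq: "\<exists>\<^sub>F n in sequentially. d \<le> (x n - c) \<bullet> u"
    define G where "G = inf sequentially (principal {n. d \<le> (x n - c) \<bullet> u})"
    have G: "G \<noteq> bot" "G \<le> sequentially"
      using freq unfolding G_def
      by (auto simp: trivial_limit_def eventually_inf_principal frequently_def)
    have X: "Bfun x G" using bdd G(2) unfolding Bfun_def by (meson filter_leD)
    obtain c' where c': "c' \<in> Fix T"
      and c'min: "\<And>y. sq_radius G x c' + (norm (y - c'))\<^sup>2 \<le> sq_radius G x y"
      using center[OF G] by blast
    \<comment> \<open>Both centers are fixed points, where the two radii agree, so each minimizes the same function.\<close>
    have "(norm (c - c'))\<^sup>2 \<le> 0"
      using cmin[of c'] c'min[of c] radius_Fix[OF G c] radius_Fix[OF G c']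
      by (smt (verit) zero_le_power2)
    then have "c' = c" by simp
    have inG: "\<forall>\<^sub>F n in G. d \<le> (x n - c) \<bullet> u"
      unfolding G_def by (simp add: eventually_inf_principal)
    \<comment> \<open>Along \<open>G\<close> the squared distance to \<open>c + u\<close> is at most that to \<open>c\<close> plus \<open>(norm u)\<^sup>2 - 2 * d\<close>, less than the excess \<open>(norm u)\<^sup>2\<close> that the center guarantees; the final \<open>+ d\<close> is slack for the limit superior.\<close>
    have "sq_radius G x (c + u) \<le> sq_radius G x c - 2 * d + (norm u)\<^sup>2 + d"
    proof (rule sq_radius_le[OF G(1)])
      have "\<forall>\<^sub>F n in G. (norm (x n - c))\<^sup>2 \<le> sq_radius G x c + d"
        by (rule eventually_le_of_sq_radius_less[OF X]) (use \<open>0 < d\<close> in simp)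
      with inG show "\<forall>\<^sub>F n in G. (norm (x n - (c + u)))\<^sup>2 \<le> sq_radius G x c - 2 * d + (norm u)\<^sup>2 + d"
      proof eventually_elim
        case (elim n)
        have "(norm (x n - (c + u)))\<^sup>2 = (norm (x n - c))\<^sup>2 - 2 * ((x n - c) \<bullet> u) + (norm u)\<^sup>2"
          by (simp add: power2_norm_eq_inner inner_diff_left inner_diff_right inner_add_left
              inner_add_right inner_commute)
        with elim show ?case by linarith
      qed
    qed
    with c'min[of "c + u"] \<open>0 < d\<close> show False by (simp add: \<open>c' = c\<close>)
  qed
  have "(\<lambda>n. x n \<bullet> u) \<longlonglongrightarrow> c \<bullet> u" for u
  proof (rule tendstoI)
    fix d :: real assume "0 < d"
    have "\<forall>\<^sub>F n in sequentially. \<not> d \<le> (x n - c) \<bullet> u" "\<forall>\<^sub>F n in sequentially. \<not> d \<le> (x n - c) \<bullet> (- u)"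
      using no_drift[OF \<open>0 < d\<close>] unfolding not_frequently by blast+
    then show "\<forall>\<^sub>F n in sequentially. dist (x n \<bullet> u) (c \<bullet> u) < d"
      by eventually_elim (auto simp: dist_real_def inner_diff_left)
  qed
  then have "weakly_converges x c" by (simp add: weakly_converges_def)
  with c show thesis by (rule that)
qed

section \<open>Operators on the product space\<close>

lemma norm_vec_sq:
  fixes x :: "'a::real_inner ^ 'n::finite"
  shows "(norm x)\<^sup>2 = (\<Sum>i\<in>UNIV. (norm (x $ i))\<^sup>2)"
  by (simp add: power2_norm_eq_inner inner_vec_def)

lemma displacement_bound_vec:
  fixes F :: "'n::finite \<Rightarrow> 'a::real_inner \<Rightarrow> 'a"
  assumes "\<And>i. displacement_bound \<tau> (F i)"
  shows "displacement_bound \<tau> (\<lambda>x. \<chi> i. F i (x $ i))"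
  unfolding displacement_bound_def norm_vec_sq sum_subtractf[symmetric] sum_distrib_left
  by (intro allI sum_mono) (simp add: displacement_boundD[OF assms])

lemma Fix_vec: "Fix (\<lambda>x. \<chi> i. F i (x $ i)) = {x. \<forall>i. x $ i \<in> Fix (F i)}"
  by (auto simp: Fix_def vec_eq_iff)

context
  fixes r :: nat and e :: "nat \<Rightarrow> 'n::finite"
  assumes r: "r \<ge> 2" and e: "bij_betw e {1..r - 1} (UNIV :: 'n set)"
begin

lemma P_W_eq_mean: "P_W r e x = (\<chi> i. (1 / real CARD('n)) *\<^sub>R (\<Sum>k\<in>UNIV. x $ k))"
proof -
  have "CARD('n) = r - 1" using bij_betw_same_card[OF e] by simp
  moreover have "(\<Sum>j = 1..r - 1. x $ e j) = (\<Sum>k\<in>UNIV. x $ k)"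
    by (rule sum.reindex_bij_betw[OF e])
  ultimately show ?thesis unfolding P_W_def by simp
qed

lemma displacement_bound_P_W:
  "displacement_bound 1 (P_W r e :: 'a::{real_inner,complete_space} ^ 'n \<Rightarrow> _)"
  unfolding displacement_bound_def
proof (intro allI)
  fix x y :: "'a ^ 'n"
  define d where "d = x - y"
  have lin: "P_W r e x - P_W r e y = P_W r e d"
    by (simp add: P_W_eq_mean d_def vec_eq_iff sum_subtractf scaleR_diff_right)
  \<comment> \<open>\<open>P_W\<close> is linear and an orthogonal projection: displacements are orthogonal to values.\<close>
  have orth: "P_W r e d \<bullet> P_W r e d = d \<bullet> P_W r e d"
  proof -
    define s where "s = (\<Sum>k\<in>UNIV. d $ k)"
    have P: "P_W r e d = (\<chi> i. (1 / real CARD('n)) *\<^sub>R s)" by (simp add: P_W_eq_mean s_def)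
    have "d \<bullet> P_W r e d = (1 / real CARD('n)) * (s \<bullet> s)"
      unfolding P inner_vec_def by (simp add: s_def inner_sum_left sum_divide_distrib)
    moreover have "P_W r e d \<bullet> P_W r e d = (1 / real CARD('n)) * (s \<bullet> s)"
      unfolding P inner_vec_def by simp
    ultimately show ?thesis by simp
  qed
  have "(x - P_W r e x) - (y - P_W r e y) = d - P_W r e d"
    unfolding lin[symmetric] unfolding d_def by simp
  then show "(norm ((x - P_W r e x) - (y - P_W r e y)))\<^sup>2 \<le>
      1 * ((norm (x - y))\<^sup>2 - (norm (P_W r e x - P_W r e y))\<^sup>2)"
    unfolding lin using orth
    by (simp add: d_def[symmetric] power2_norm_eq_inner inner_diff_left inner_diff_right inner_commute)
qed

lemma Fix_P_W: "Fix (P_W r e :: 'a::{real_inner,complete_space} ^ 'n \<Rightarrow> _) = W_set"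
proof
  show "Fix (P_W r e :: 'a ^ 'n \<Rightarrow> _) \<subseteq> W_set"
  proof
    fix x :: "'a ^ 'n" assume "x \<in> Fix (P_W r e)"
    then have "P_W r e x = x" by (simp add: Fix_def)
    moreover have "P_W r e x $ i = (1 / real CARD('n)) *\<^sub>R (\<Sum>k\<in>UNIV. x $ k)" for i
      by (simp add: P_W_eq_mean)
    ultimately have mean: "(1 / real CARD('n)) *\<^sub>R (\<Sum>k\<in>UNIV. x $ k) = x $ i" for i
      by metis
    have "x $ i = x $ j" for i j
      by (rule trans[OF mean[of i, symmetric] mean[of j]])
    then show "x \<in> W_set" unfolding W_set_def by blast
  qed
  show "W_set \<subseteq> Fix (P_W r e :: 'a ^ 'n \<Rightarrow> _)"
  proof
    fix x :: "'a ^ 'n" assume x: "x \<in> W_set"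
    have "(\<Sum>k\<in>UNIV. x $ k) = (\<Sum>k\<in>(UNIV :: 'n set). x $ i)" for i
      by (rule sum.cong[OF refl]) (use x in \<open>unfold W_set_def, blast\<close>)
    then have sum: "(\<Sum>k\<in>UNIV. x $ k) = real CARD('n) *\<^sub>R x $ i" for i
      by (simp only: sum_constant_scaleR)
    have "P_W r e x $ i = x $ i" for i
    proof -
      have "P_W r e x $ i = (1 / real CARD('n)) *\<^sub>R (\<Sum>k\<in>UNIV. x $ k)"
        by (simp add: P_W_eq_mean)
      also have "\<dots> = x $ i" unfolding sum[of i] by simp
      finally show ?thesis .
    qed
    then show "x \<in> Fix (P_W r e)" unfolding Fix_def vec_eq_iff by blast
  qed
qed

context
  fixes K :: "nat \<Rightarrow> 'a::{real_inner,complete_space} set"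
  assumes cl: "\<And>j. j \<in> {1..r} \<Longrightarrow> closed (K j)"
    and cv: "\<And>j. j \<in> {1..r} \<Longrightarrow> convex (K j)"
    and ne: "(\<Inter>j\<in>{1..r}. K j) \<noteq> {}"
begin

definition Q_coord :: "nat \<Rightarrow> 'a \<Rightarrow> 'a" where
  "Q_coord j = (if j = r - 1 then proj (K (r - 1)) \<circ> proj (K r) else proj (K j))"

lemma Q_V_eq: "Q_V r e K = (\<lambda>x. \<chi> i. Q_coord (the_inv_into {1..r - 1} e i) (x $ i))"
  by (auto simp: fun_eq_iff Q_V_def Q_coord_def Let_def vec_eq_iff)

lemma inv_e_in: "the_inv_into {1..r - 1} e i \<in> {1..r - 1}"
  using e by (intro the_inv_into_into) (auto simp: bij_betw_def)

lemma K_projectable: "j \<in> {1..r} \<Longrightarrow> closed (K j) \<and> convex (K j) \<and> K j \<noteq> {}"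
  using cl cv ne by blast

lemma displacement_bound_proj_K: "j \<in> {1..r} \<Longrightarrow> displacement_bound 1 (proj (K j))"
  using K_projectable by (intro displacement_bound_proj) auto

text \<open>
  The coordinate with two projectors has parameter \<open>1 + 1\<close>; the others are relaxed from \<open>1\<close> to \<open>2\<close>.
\<close>

lemma displacement_bound_Q_V: "displacement_bound 2 (Q_V r e K)"
  unfolding Q_V_eq
proof (rule displacement_bound_vec)
  fix i :: 'n
  let ?j = "the_inv_into {1..r - 1} e i"
  have j: "?j \<in> {1..r}" using inv_e_in[of i] by auto
  have "displacement_bound (1 + 1) (proj (K (r - 1)) \<circ> proj (K r))"
    using r by (intro displacement_bound_comp displacement_bound_proj_K) auto
  moreover have "displacement_bound 2 (proj (K ?j))"
    by (rule displacement_bound_mono[OF displacement_bound_proj_K[OF j]]) auto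
  ultimately show "displacement_bound 2 (Q_coord ?j)" by (simp add: Q_coord_def)
qed

lemma displacement_bound_Q_V_affine:
  assumes "proj (K (r - 1)) ` K r \<subseteq> K r" "affine (K r)"
  shows "displacement_bound 1 (Q_V r e K)"
  unfolding Q_V_eq
proof (rule displacement_bound_vec)
  fix i :: 'n
  let ?j = "the_inv_into {1..r - 1} e i"
  have j: "?j \<in> {1..r}" using inv_e_in[of i] by auto
  have rr: "r \<in> {1..r}" "r - 1 \<in> {1..r}" using r by auto
  have ne2: "K (r - 1) \<inter> K r \<noteq> {}" using ne rr by blast
  have "proj (K (r - 1)) \<circ> proj (K r) = proj (K (r - 1) \<inter> K r)"
    using proj_comp_eq_proj_Int[OF _ _ _ assms(2) ne2 assms(1)] K_projectable rr
    by (auto simp: fun_eq_iff)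
  moreover have "displacement_bound 1 (proj (K (r - 1) \<inter> K r))"
    using ne2 K_projectable rr by (intro displacement_bound_proj closed_Int convex_Int) auto
  ultimately show "displacement_bound 1 (Q_coord ?j)"
    using displacement_bound_proj_K[OF j] by (simp add: Q_coord_def)
qed

lemma Fix_Q_coord:
  assumes "j \<in> {1..r - 1}"
  shows "Fix (Q_coord j) = (if j = r - 1 then K (r - 1) \<inter> K r else K j)"
proof -
  have rr: "r \<in> {1..r}" "r - 1 \<in> {1..r}" "j \<in> {1..r}" using r assms by auto
  have F: "Fix (proj (K k)) = K k" if "k \<in> {1..r}" for k
    using K_projectable[OF that] by (simp add: Fix_proj)
  have "Fix (proj (K (r - 1))) \<inter> Fix (proj (K r)) \<noteq> {}"
    unfolding F[OF rr(1)] F[OF rr(2)] using ne rr by blast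
  from Fix_comp[OF displacement_bound_proj_K[OF rr(2)] _ displacement_bound_proj_K[OF rr(1)] _ this]
  show ?thesis using F rr by (simp add: Q_coord_def)
qed

lemma Fix_Q_V: "Fix (Q_V r e K) = V_set r e K"
proof -
  have inv: "the_inv_into {1..r - 1} e (e j) = j" if "j \<in> {1..r - 1}" for j
    using e that by (intro the_inv_into_f_f) (auto simp: bij_betw_def)
  have surj: "(\<forall>i. P i) \<longleftrightarrow> (\<forall>j\<in>{1..r - 1}. P (e j))" for P
    using bij_betw_imp_surj_on[OF e] by (metis UNIV_I imageE)
  have split: "{1..r - 1} = insert (r - 1) {1..r - 2}" and neq: "\<And>j. j \<in> {1..r - 2} \<Longrightarrow> j \<noteq> r - 1"
    using r by auto
  have "x \<in> Fix (Q_V r e K) \<longleftrightarrow> x \<in> V_set r e K" for x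
  proof -
    have "x \<in> Fix (Q_V r e K) \<longleftrightarrow>
        (\<forall>j\<in>{1..r - 1}. x $ e j \<in> Fix (Q_coord (the_inv_into {1..r - 1} e (e j))))"
      unfolding Q_V_eq Fix_vec[of "\<lambda>i. Q_coord (the_inv_into {1..r - 1} e i)"] mem_Collect_eq
      by (rule surj[of "\<lambda>i. x $ i \<in> Fix (Q_coord (the_inv_into {1..r - 1} e i))"])
    also have "\<dots> \<longleftrightarrow> (\<forall>j\<in>{1..r - 1}. x $ e j \<in> (if j = r - 1 then K (r - 1) \<inter> K r else K j))"
      by (intro ball_cong refl) (simp only: inv Fix_Q_coord)
    also have "\<dots> \<longleftrightarrow> x \<in> V_set r e K"
      unfolding split V_set_def using neq by auto
    finally show ?thesis .
  qed
  then show ?thesis by blast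
qed

lemma V_Int_W: "V_set r e K \<inter> W_set = {x. \<exists>z\<in>(\<Inter>j\<in>{1..r}. K j). \<forall>i. x $ i = z}"
proof -
  have "{1..r} = insert r (insert (r - 1) {1..r - 2})" using r by auto
  then have V: "x \<in> V_set r e K \<longleftrightarrow> z \<in> (\<Inter>j\<in>{1..r}. K j)" if "\<forall>i. x $ i = z" for x :: "'a ^ 'n" and z
    using that by (auto simp: V_set_def)
  show ?thesis
  proof (intro set_eqI iffI)
    fix x :: "'a ^ 'n" assume x: "x \<in> V_set r e K \<inter> W_set"
    \<comment> \<open>\<open>undefined\<close> is just some index; all coordinates agree.\<close>
    then have const: "\<forall>i. x $ i = x $ undefined" unfolding W_set_def by blast
    have "x $ undefined \<in> (\<Inter>j\<in>{1..r}. K j)" using V[OF const] x by blast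
    with const show "x \<in> {x. \<exists>z\<in>(\<Inter>j\<in>{1..r}. K j). \<forall>i. x $ i = z}" by blast
  next
    fix x :: "'a ^ 'n" assume "x \<in> {x. \<exists>z\<in>(\<Inter>j\<in>{1..r}. K j). \<forall>i. x $ i = z}"
    then obtain z where z: "z \<in> (\<Inter>j\<in>{1..r}. K j)" "\<forall>i. x $ i = z" by blast
    then have "x \<in> W_set" by (simp add: W_set_def)
    with V[OF z(2)] z(1) show "x \<in> V_set r e K \<inter> W_set" by blast
  qed
qed

lemma Fix_reduced_MAP: "Fix (reduced_MAP r e K) = V_set r e K \<inter> W_set"
proof -
  obtain z where "z \<in> (\<Inter>j\<in>{1..r}. K j)" using ne by blast
  then have "(\<chi> i. z) \<in> V_set r e K \<inter> W_set" unfolding V_Int_W by auto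
  then have "Fix (P_W r e) \<inter> Fix (Q_V r e K) \<noteq> {}" unfolding Fix_P_W Fix_Q_V by blast
  from Fix_comp[OF displacement_bound_P_W _ displacement_bound_Q_V _ this]
  show ?thesis by (simp add: reduced_MAP_def Fix_P_W Fix_Q_V Int_commute)
qed

lemma displacement_bound_reduced_MAP: "displacement_bound 3 (reduced_MAP r e K)"
  using displacement_bound_comp[OF displacement_bound_P_W _ displacement_bound_Q_V]
  by (simp add: reduced_MAP_def)

lemma displacement_bound_reduced_MAP_affine:
  assumes "proj (K (r - 1)) ` K r \<subseteq> K r" "affine (K r)"
  shows "displacement_bound 2 (reduced_MAP r e K)"
  using displacement_bound_comp[OF displacement_bound_P_W _ displacement_bound_Q_V_affine[OF assms]]
  by (simp add: reduced_MAP_def)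

end

end

theorem theorem3p6:
  fixes r :: nat
    and e :: "nat \<Rightarrow> 'n::finite"
    and K :: "nat \<Rightarrow> 'a::{real_inner,complete_space} set"
  assumes "r \<ge> 2"
    and "bij_betw e {1..r - 1} (UNIV :: 'n set)"
    and "\<And>j. j \<in> {1..r} \<Longrightarrow> closed (K j)"
    and "\<And>j. j \<in> {1..r} \<Longrightarrow> convex (K j)"
    and "(\<Inter>j\<in>{1..r}. K j) \<noteq> {}"
  shows "(Fix (reduced_MAP r e K) = V_set r e K \<inter> W_set \<and>
          V_set r e K \<inter> W_set = {x :: 'a ^ 'n. \<exists>z \<in> (\<Inter>j\<in>{1..r}. K j). \<forall>i. x $ i = z})
       \<and> (averaged_on (3/4) UNIV (reduced_MAP r e K) \<and>
          (proj (K (r - 1)) ` K r \<subseteq> K r \<and> affine (K r) \<longrightarrow>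
             averaged_on (2/3) UNIV (reduced_MAP r e K)))
       \<and> (\<forall>x :: nat \<Rightarrow> 'a ^ 'n. (\<forall>n. x (Suc n) = reduced_MAP r e K (x n)) \<longrightarrow>
          (\<exists>z. z \<in> (\<Inter>j\<in>{1..r}. K j) \<and> (\<chi> i. z) \<in> V_set r e K \<inter> W_set \<and>
               weakly_converges x (\<chi> i. z)))"
proof (intro conjI allI impI)
  show fix_S: "Fix (reduced_MAP r e K) = V_set r e K \<inter> W_set"
    by (rule Fix_reduced_MAP[OF assms])
  show diag: "V_set r e K \<inter> W_set = {x :: 'a ^ 'n. \<exists>z \<in> (\<Inter>j\<in>{1..r}. K j). \<forall>i. x $ i = z}"
    by (rule V_Int_W[OF assms])
  show "averaged_on (3/4) UNIV (reduced_MAP r e K)"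
    using displacement_bound_averaged[OF displacement_bound_reduced_MAP[OF assms]] by simp
  show "averaged_on (2/3) UNIV (reduced_MAP r e K)"
    if "proj (K (r - 1)) ` K r \<subseteq> K r \<and> affine (K r)"
    using displacement_bound_averaged[OF displacement_bound_reduced_MAP_affine[OF assms]] that by simp
  \<comment> \<open>The weak limit is a fixed point, hence a diagonal point of the intersection.\<close>
  fix x :: "nat \<Rightarrow> 'a ^ 'n"
  assume x: "\<forall>n. x (Suc n) = reduced_MAP r e K (x n)"
  have "Fix (reduced_MAP r e K) \<noteq> {}"
  proof -
    obtain z where "z \<in> (\<Inter>j\<in>{1..r}. K j)" using assms(5) by blast
    then have "(\<chi> i. z) \<in> Fix (reduced_MAP r e K)" unfolding fix_S diag by auto
    then show ?thesis by blast
  qed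
  then obtain c where c: "c \<in> Fix (reduced_MAP r e K)" "weakly_converges x c"
    using averaged_iterates_weakly_converge[OF displacement_bound_reduced_MAP[OF assms], of x] x by auto
  then obtain z where z: "z \<in> (\<Inter>j\<in>{1..r}. K j)" "\<forall>i. c $ i = z" unfolding fix_S diag by blast
  then have "c = (\<chi> i. z)" by (simp add: vec_eq_iff)
  with c z fix_S show "\<exists>z. z \<in> (\<Inter>j\<in>{1..r}. K j) \<and> (\<chi> i. z) \<in> V_set r e K \<inter> W_set \<and>
      weakly_converges x (\<chi> i. z)" by auto
qed

end
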